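(* Let $A, B, C$ be a right regular triple of semigroups. If $A$ is simple, then $C$ is also simple.
   Context: A semigroup is a nonempty set with an associative multiplication. For a semigroup $S$, a nonempty set $\Lambda$ and a mapping $P:\Lambda\to S$, let $\mathcal{M}(S;\Lambda;P)$ denote the semigroup on the set $S\times\Lambda$ with multiplication $(s,\lambda)(t,\mu)=(sP(\lambda)t,\mu)$. For a semigroup $S$, $\theta_S=\{(a,b)\in S\times S: xa=xb \text{ for all } x\in S\}$; this is a congruence on $S$. A triple $A,B,C$ of semigroups is called right regular if there exist mappings (not necessarily homomorphisms) $P:B\to A$ and $P':B\to C$ such that $\mathcal{M}(A;B;P)/\theta_{\mathcal{M}(A;B;P)}\cong\mathcal{M}(C;B;P')$ as semigroups. A semigroup $S$ is simple if $S$ is its only (nonempty, two-sided) ideal; equivalently, $SaS=S$ for every $a\in S$. *)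

theory Defs
  imports "HOL-Algebra.Group"
begin

text \<open>
  Semigroups are carried by the \<^typ>\<open>('a, 'm) monoid_scheme\<close> records, so that the library's
  \<^const>\<open>hom\<close>, \<^const>\<open>iso\<close> and \<^const>\<open>is_iso\<close>, which only refer to the carrier and the multiplication,
  apply directly. The \<^const>\<open>one\<close> field carries no meaning: nothing is assumed about it, and it is
  \<^term>\<open>undefined\<close> in the semigroups constructed below.
\<close>

locale semigroup_struct =
  fixes S (structure)
  assumes carrier_not_empty: "carrier S \<noteq> {}"
    and m_closed [intro, simp]: "x \<in> carrier S \<Longrightarrow> y \<in> carrier S \<Longrightarrow> x \<otimes> y \<in> carrier S"
    and m_assoc: "x \<in> carrier S \<Longrightarrow> y \<in> carrier S \<Longrightarrow> z \<in> carrier S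
      \<Longrightarrow> (x \<otimes> y) \<otimes> z = x \<otimes> (y \<otimes> z)"

definition semigroup_ideal :: "'a set \<Rightarrow> ('a, 'm) monoid_scheme \<Rightarrow> bool"
  where "semigroup_ideal I S \<longleftrightarrow> I \<subseteq> carrier S \<and> I \<noteq> {} \<and>
    (\<forall>s \<in> carrier S. \<forall>i \<in> I. s \<otimes>\<^bsub>S\<^esub> i \<in> I \<and> i \<otimes>\<^bsub>S\<^esub> s \<in> I)"

definition simple_semigroup :: "('a, 'm) monoid_scheme \<Rightarrow> bool"
  where "simple_semigroup S \<longleftrightarrow> semigroup_struct S \<and> (\<forall>I. semigroup_ideal I S \<longrightarrow> I = carrier S)"

text \<open>The semigroup $\mathcal{M}(S;\Lambda;P)$.\<close>

definition sandwich :: "('a, 'm) monoid_scheme \<Rightarrow> 'i set \<Rightarrow> ('i \<Rightarrow> 'a) \<Rightarrow> ('a \<times> 'i) monoid"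
  where "sandwich S \<Lambda> P =
    \<lparr>carrier = carrier S \<times> \<Lambda>,
     mult = (\<lambda>(s, l) (t, m). (s \<otimes>\<^bsub>S\<^esub> P l \<otimes>\<^bsub>S\<^esub> t, m)),
     one = undefined\<rparr>"

definition theta :: "('a, 'm) monoid_scheme \<Rightarrow> ('a \<times> 'a) set"
  where "theta S = {(a, b). a \<in> carrier S \<and> b \<in> carrier S \<and>
    (\<forall>x \<in> carrier S. x \<otimes>\<^bsub>S\<^esub> a = x \<otimes>\<^bsub>S\<^esub> b)}"

definition congruence_on :: "('a, 'm) monoid_scheme \<Rightarrow> ('a \<times> 'a) set \<Rightarrow> bool"
  where "congruence_on S r \<longleftrightarrow> equiv (carrier S) r \<and>
    (\<forall>(a, b) \<in> r. \<forall>(c, d) \<in> r. (a \<otimes>\<^bsub>S\<^esub> c, b \<otimes>\<^bsub>S\<^esub> d) \<in> r)"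

text \<open>
  For a congruence \<open>r\<close>, the classes of the products \<open>x \<otimes> y\<close> of representatives all coincide, so
  the union below is the single class of the product (see \<open>mult_quotient_semigroup\<close>).
\<close>

definition quotient_semigroup :: "('a, 'm) monoid_scheme \<Rightarrow> ('a \<times> 'a) set \<Rightarrow> 'a set monoid"
  where "quotient_semigroup S r =
    \<lparr>carrier = carrier S // r,
     mult = (\<lambda>X Y. \<Union>x \<in> X. \<Union>y \<in> Y. r `` {x \<otimes>\<^bsub>S\<^esub> y}),
     one = undefined\<rparr>"

definition right_regular_triple ::
    "('a, 'm) monoid_scheme \<Rightarrow> ('b, 'n) monoid_scheme \<Rightarrow> ('c, 'k) monoid_scheme \<Rightarrow> bool"
  where "right_regular_triple A B C \<longleftrightarrow>
    semigroup_struct A \<and> semigroup_struct B \<and> semigroup_struct C \<and>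
    (\<exists>P \<in> carrier B \<rightarrow> carrier A. \<exists>P' \<in> carrier B \<rightarrow> carrier C.
      quotient_semigroup (sandwich A (carrier B) P) (theta (sandwich A (carrier B) P))
        \<cong> sandwich C (carrier B) P')"

lemma semigroup_sandwich:
  assumes "semigroup_struct S" "\<Lambda> \<noteq> {}" "P \<in> \<Lambda> \<rightarrow> carrier S"
  shows "semigroup_struct (sandwich S \<Lambda> P)"
proof -
  interpret semigroup_struct S by fact
  have P: "P l \<in> carrier S" if "l \<in> \<Lambda>" for l using assms(3) that by auto
  show ?thesis
    by unfold_locales (use assms(2) carrier_not_empty in \<open>auto simp: sandwich_def P m_assoc\<close>)
qed

lemma congruence_theta:
  assumes "semigroup_struct S"
  shows "congruence_on S (theta S)"
proof -
  interpret semigroup_struct S by fact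
  have "equiv (carrier S) (theta S)"
    by (rule equivI) (auto simp: theta_def refl_on_def sym_def trans_def)
  moreover have "(a \<otimes>\<^bsub>S\<^esub> c, b \<otimes>\<^bsub>S\<^esub> d) \<in> theta S"
    if ab: "(a, b) \<in> theta S" and cd: "(c, d) \<in> theta S" for a b c d
  proof -
    have car: "a \<in> carrier S" "b \<in> carrier S" "c \<in> carrier S" "d \<in> carrier S"
      using ab cd by (simp_all add: theta_def)
    have "x \<otimes>\<^bsub>S\<^esub> (a \<otimes>\<^bsub>S\<^esub> c) = x \<otimes>\<^bsub>S\<^esub> (b \<otimes>\<^bsub>S\<^esub> d)" if x: "x \<in> carrier S" for x
    proof -
      have "x \<otimes>\<^bsub>S\<^esub> (a \<otimes>\<^bsub>S\<^esub> c) = (x \<otimes>\<^bsub>S\<^esub> a) \<otimes>\<^bsub>S\<^esub> c" using car x by (simp add: m_assoc)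
      also have "\<dots> = (x \<otimes>\<^bsub>S\<^esub> a) \<otimes>\<^bsub>S\<^esub> d" using cd car x by (simp add: theta_def)
      also have "\<dots> = (x \<otimes>\<^bsub>S\<^esub> b) \<otimes>\<^bsub>S\<^esub> d" using ab x by (simp add: theta_def)
      finally show ?thesis using car x by (simp add: m_assoc)
    qed
    then show ?thesis using car by (simp add: theta_def)
  qed
  ultimately show ?thesis by (auto simp: congruence_on_def)
qed

lemma mult_quotient_semigroup:
  assumes "congruence_on S r" "x \<in> carrier S" "y \<in> carrier S"
  shows "r `` {x} \<otimes>\<^bsub>quotient_semigroup S r\<^esub> r `` {y} = r `` {x \<otimes>\<^bsub>S\<^esub> y}"
proof -
  have eq: "equiv (carrier S) r" using assms(1) by (simp add: congruence_on_def)
  have *: "r `` {u \<otimes>\<^bsub>S\<^esub> v} = r `` {x \<otimes>\<^bsub>S\<^esub> y}" if "u \<in> r `` {x}" "v \<in> r `` {y}" for u v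
  proof -
    have "(x \<otimes>\<^bsub>S\<^esub> y, u \<otimes>\<^bsub>S\<^esub> v) \<in> r" using assms(1) that by (auto simp: congruence_on_def)
    then show ?thesis by (rule equiv_class_eq[OF eq, symmetric])
  qed
  have ne: "r `` {x} \<noteq> {}" "r `` {y} \<noteq> {}"
    using equiv_class_self[OF eq] assms(2,3) by blast+
  have "(\<Union>u \<in> r `` {x}. \<Union>v \<in> r `` {y}. r `` {u \<otimes>\<^bsub>S\<^esub> v})
      = (\<Union>u \<in> r `` {x}. \<Union>v \<in> r `` {y}. r `` {x \<otimes>\<^bsub>S\<^esub> y})"
    by (intro SUP_cong refl *)
  also have "\<dots> = r `` {x \<otimes>\<^bsub>S\<^esub> y}" using ne by simp
  finally show ?thesis by (simp add: quotient_semigroup_def)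
qed

lemma semigroup_quotient:
  assumes "semigroup_struct S" "congruence_on S r"
  shows "semigroup_struct (quotient_semigroup S r)"
proof -
  interpret semigroup_struct S by fact
  have car: "carrier (quotient_semigroup S r) = carrier S // r"
    by (simp add: quotient_semigroup_def)
  note mult = mult_quotient_semigroup[OF assms(2)]
  show ?thesis
  proof
    show "carrier (quotient_semigroup S r) \<noteq> {}"
      using carrier_not_empty by (auto simp: car quotient_def)
  next
    fix X Y assume "X \<in> carrier (quotient_semigroup S r)" "Y \<in> carrier (quotient_semigroup S r)"
    then obtain x y where "x \<in> carrier S" "y \<in> carrier S" "X = r `` {x}" "Y = r `` {y}"
      unfolding car by (elim quotientE)
    then show "X \<otimes>\<^bsub>quotient_semigroup S r\<^esub> Y \<in> carrier (quotient_semigroup S r)"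
      by (simp add: car mult quotientI)
  next
    fix X Y Z assume "X \<in> carrier (quotient_semigroup S r)" "Y \<in> carrier (quotient_semigroup S r)"
      "Z \<in> carrier (quotient_semigroup S r)"
    then obtain x y z where "x \<in> carrier S" "y \<in> carrier S" "z \<in> carrier S"
      "X = r `` {x}" "Y = r `` {y}" "Z = r `` {z}"
      unfolding car by (elim quotientE)
    then show "X \<otimes>\<^bsub>quotient_semigroup S r\<^esub> Y \<otimes>\<^bsub>quotient_semigroup S r\<^esub> Z
        = X \<otimes>\<^bsub>quotient_semigroup S r\<^esub> (Y \<otimes>\<^bsub>quotient_semigroup S r\<^esub> Z)"
      by (simp add: mult m_assoc)
  qed
qed

end

theory Submission
  imports Defs
begin

text \<open>
  If \<open>A\<close> is simple, so is \<open>M(A;B;P)\<close>: the products \<open>(s,l)(a,l)(t,m) = (s P(l)aP(l) t, m)\<close> reach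
  every element, because \<open>A c A = A\<close> for \<open>c = P(l)aP(l)\<close>. Simplicity passes to homomorphic images,
  hence to \<open>M(C;B;P')\<close>, and there each ideal \<open>I\<close> of \<open>C\<close> yields the ideal \<open>I \<times> B\<close>.
\<close>

lemma simple_semigroupD: "simple_semigroup S \<Longrightarrow> semigroup_ideal I S \<Longrightarrow> I = carrier S"
  by (simp only: simple_semigroup_def)

text \<open>Links the ideal form of simplicity to the form \<open>S c S = S\<close>, which supplies
  solutions of \<open>x = s \<otimes> c \<otimes> t\<close>. A further factor on the left is
  absorbed into \<open>s\<close>, one on the right into \<open>t\<close>. Without an identity,
  \<open>c\<close> itself need not belong to this ideal.\<close>

lemma (in semigroup_struct) semigroup_ideal_principal:
  assumes "c \<in> carrier S"
  shows "semigroup_ideal {s \<otimes> c \<otimes> t | s t. s \<in> carrier S \<and> t \<in> carrier S} S"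
proof -
  let ?J = "{s \<otimes> c \<otimes> t | s t. s \<in> carrier S \<and> t \<in> carrier S}"
  have "?J \<subseteq> carrier S" using assms by blast
  moreover have "?J \<noteq> {}" using carrier_not_empty by blast
  moreover have "u \<otimes> x \<in> ?J \<and> x \<otimes> u \<in> ?J" if u: "u \<in> carrier S" and "x \<in> ?J" for u x
  proof -
    obtain s t where x: "x = s \<otimes> c \<otimes> t" and st: "s \<in> carrier S" "t \<in> carrier S"
      using \<open>x \<in> ?J\<close> by blast
    have "u \<otimes> x = (u \<otimes> s) \<otimes> c \<otimes> t" "x \<otimes> u = s \<otimes> c \<otimes> (t \<otimes> u)"
      using assms u st by (simp_all add: x m_assoc)
    then show ?thesis using u st by blast
  qed
  ultimately show ?thesis unfolding semigroup_ideal_def by blast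
qed

lemma simple_sandwich:
  assumes simple: "simple_semigroup S" and "\<Lambda> \<noteq> {}" and P: "P \<in> \<Lambda> \<rightarrow> carrier S"
  shows "simple_semigroup (sandwich S \<Lambda> P)"
proof -
  let ?M = "sandwich S \<Lambda> P"
  interpret semigroup_struct S using simple by (simp add: simple_semigroup_def)
  have "I = carrier ?M" if I: "semigroup_ideal I ?M" for I
  proof
    show "I \<subseteq> carrier ?M" using I by (simp add: semigroup_ideal_def)
    obtain a l where al: "(a, l) \<in> I" using I by (auto simp: semigroup_ideal_def)
    then have a: "a \<in> carrier S" and l: "l \<in> \<Lambda>"
      using I by (auto simp: semigroup_ideal_def sandwich_def)
    have Pl: "P l \<in> carrier S" using P l by auto
    \<comment> \<open>The right \<open>P l\<close> is forced by the index of \<open>(a, l)\<close>;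
      the left one comes from giving the factor \<open>(s, l)\<close> that same index.\<close>
    let ?c = "P l \<otimes>\<^bsub>S\<^esub> a \<otimes>\<^bsub>S\<^esub> P l"
    have c: "?c \<in> carrier S" using Pl a by simp
    show "carrier ?M \<subseteq> I"
    proof
      fix z assume "z \<in> carrier ?M"
      then obtain x m where z: "z = (x, m)" and x: "x \<in> carrier S" and m: "m \<in> \<Lambda>"
        by (auto simp: sandwich_def)
      have "carrier S = {s \<otimes>\<^bsub>S\<^esub> ?c \<otimes>\<^bsub>S\<^esub> t | s t. s \<in> carrier S \<and> t \<in> carrier S}"
        by (rule simple_semigroupD[OF simple semigroup_ideal_principal[OF c], symmetric])
      with x obtain s t where st: "s \<in> carrier S" "t \<in> carrier S"
        and xst: "x = s \<otimes>\<^bsub>S\<^esub> ?c \<otimes>\<^bsub>S\<^esub> t" by blast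
      \<comment> \<open>A product takes its index from the last factor, so \<open>(t, m)\<close>
        moves the result to the prescribed index \<open>m\<close>, while \<open>s\<close> and
        \<open>t\<close> adjust the first coordinate to \<open>x\<close>.\<close>
      have "(s, l) \<in> carrier ?M" "(t, m) \<in> carrier ?M"
        using st l m by (simp_all add: sandwich_def)
      with I al have "(s, l) \<otimes>\<^bsub>?M\<^esub> (a, l) \<otimes>\<^bsub>?M\<^esub> (t, m) \<in> I"
        by (simp add: semigroup_ideal_def)
      moreover have "(s, l) \<otimes>\<^bsub>?M\<^esub> (a, l) \<otimes>\<^bsub>?M\<^esub> (t, m) = z"
        using st a Pl by (simp add: sandwich_def z xst m_assoc)
      ultimately show "z \<in> I" by simp
    qed
  qed
  then show ?thesis
    using semigroup_sandwich[OF _ assms(2) P] semigroup_struct_axioms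
    by (simp add: simple_semigroup_def)
qed

lemma simple_semigroup_of_sandwich:
  assumes "semigroup_struct S" and "\<Lambda> \<noteq> {}" and P: "P \<in> \<Lambda> \<rightarrow> carrier S"
    and simple: "simple_semigroup (sandwich S \<Lambda> P)"
  shows "simple_semigroup S"
proof -
  interpret semigroup_struct S by fact
  have "I = carrier S" if I: "semigroup_ideal I S" for I
  proof -
    have "semigroup_ideal (I \<times> \<Lambda>) (sandwich S \<Lambda> P)"
      unfolding semigroup_ideal_def
    proof (intro conjI ballI)
      show "I \<times> \<Lambda> \<subseteq> carrier (sandwich S \<Lambda> P)" "I \<times> \<Lambda> \<noteq> {}"
        using I assms(2) by (auto simp: semigroup_ideal_def sandwich_def)
    next
      fix x i assume "x \<in> carrier (sandwich S \<Lambda> P)" "i \<in> I \<times> \<Lambda>"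
      then obtain s l a m where x: "x = (s, l)" "s \<in> carrier S" "l \<in> \<Lambda>"
        and i: "i = (a, m)" "a \<in> I" "m \<in> \<Lambda>"
        by (auto simp: sandwich_def)
      \<comment> \<open>The first coordinates of the two products are \<open>s P(l) a\<close> and
        \<open>a P(m) s\<close>. Both lie in \<open>I\<close>, since the ideal absorbs the sandwich
        entry as well as \<open>s\<close>.\<close>
      have "P l \<in> carrier S" "P m \<in> carrier S" using P x i by auto
      with x i I show "x \<otimes>\<^bsub>sandwich S \<Lambda> P\<^esub> i \<in> I \<times> \<Lambda>" "i \<otimes>\<^bsub>sandwich S \<Lambda> P\<^esub> x \<in> I \<times> \<Lambda>"
        by (simp_all add: semigroup_ideal_def sandwich_def)
    qed
    then have "I \<times> \<Lambda> = carrier (sandwich S \<Lambda> P)"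
      by (rule simple_semigroupD[OF simple])
    then have "I \<times> \<Lambda> = carrier S \<times> \<Lambda>" by (simp add: sandwich_def)
    \<comment> \<open>Fixing one index in the nonempty \<open>\<Lambda>\<close> recovers the first
      factor of each product set.\<close>
    with assms(2) show ?thesis by blast
  qed
  with assms(1) show ?thesis by (simp add: simple_semigroup_def)
qed

text \<open>The preimage of an ideal under a surjective homomorphism is an ideal, with surjectivity
  ensuring that it is nonempty. Simplicity of \<open>S\<close> makes it all of \<open>S\<close>, so
  the ideal contains the whole image.\<close>

lemma simple_semigroup_epi_image:
  assumes simple: "simple_semigroup S" and T: "semigroup_struct T"
    and h: "h \<in> epi S T"
  shows "simple_semigroup T"
proof -
  have surj: "h ` carrier S = carrier T" and hom: "h \<in> hom S T"
    using h by (auto simp: epi_def)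
  interpret semigroup_struct S using simple by (simp add: simple_semigroup_def)
  have "I = carrier T" if I: "semigroup_ideal I T" for I
  proof -
    obtain i where i: "i \<in> I" "i \<in> carrier T" using I by (auto simp: semigroup_ideal_def)
    then have "i \<in> h ` carrier S" by (simp add: surj)
    with i have "{x \<in> carrier S. h x \<in> I} \<noteq> {}" by blast
    moreover have "h s \<in> carrier T" if "s \<in> carrier S" for s using hom that by (auto simp: hom_def)
    ultimately have "semigroup_ideal {x \<in> carrier S. h x \<in> I} S"
      using I by (simp add: semigroup_ideal_def hom_mult[OF hom])
    then have "{x \<in> carrier S. h x \<in> I} = carrier S"
      by (rule simple_semigroupD[OF simple])
    then have "h ` carrier S \<subseteq> I" by blast
    with I show ?thesis by (simp add: surj semigroup_ideal_def)
  qed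
  with T show ?thesis by (simp add: simple_semigroup_def)
qed

text \<open>Presents the quotient as an epimorphic image, so that simplicity descends to it.\<close>

lemma quotient_semigroup_epi:
  assumes "congruence_on S r" and m_closed: "\<And>x y. x \<in> carrier S \<Longrightarrow> y \<in> carrier S \<Longrightarrow> x \<otimes>\<^bsub>S\<^esub> y \<in> carrier S"
  shows "(\<lambda>x. r `` {x}) \<in> epi S (quotient_semigroup S r)"
proof -
  have "carrier (quotient_semigroup S r) = carrier S // r"
    by (simp add: quotient_semigroup_def)
  then show ?thesis
    by (auto simp: epi_def hom_def mult_quotient_semigroup[OF assms(1)] quotient_def)
qed

theorem theorem3:
  fixes A :: "('a, 'm) monoid_scheme"
    and B :: "('b, 'n) monoid_scheme"
    and C :: "('c, 'k) monoid_scheme"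
  assumes "right_regular_triple A B C"
    and "simple_semigroup A"
  shows "simple_semigroup C"
proof -
  have A: "semigroup_struct A" and C: "semigroup_struct C" and B: "carrier B \<noteq> {}"
    using assms(1) by (auto simp: right_regular_triple_def semigroup_struct_def)
  obtain P P' where P: "P \<in> carrier B \<rightarrow> carrier A" and P': "P' \<in> carrier B \<rightarrow> carrier C"
    and is_iso: "quotient_semigroup (sandwich A (carrier B) P) (theta (sandwich A (carrier B) P))
      \<cong> sandwich C (carrier B) P'"
    using assms(1) by (auto simp: right_regular_triple_def)
  let ?M = "sandwich A (carrier B) P"
  let ?Q = "quotient_semigroup ?M (theta ?M)"
  let ?N = "sandwich C (carrier B) P'"
  obtain h where "h \<in> iso ?Q ?N" using is_iso by (auto simp: is_iso_def)
  \<comment> \<open>Simplicity will travel along the epimorphisms \<open>?M\<close> to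
    \<open>?Q\<close> to \<open>?N\<close>, the second of which is the isomorphism
    \<open>h\<close>.\<close>
  then have h: "h \<in> epi ?Q ?N" by (simp add: iso_iff_mon_epi)
  have M: "semigroup_struct ?M" by (rule semigroup_sandwich[OF A B P])
  have "(\<lambda>x. theta ?M `` {x}) \<in> epi ?M ?Q"
    by (rule quotient_semigroup_epi[OF congruence_theta[OF M] semigroup_struct.m_closed[OF M]])
  then have "simple_semigroup ?Q"
    by (rule simple_semigroup_epi_image[OF simple_sandwich[OF assms(2) B P]
          semigroup_quotient[OF M congruence_theta[OF M]]])
  then have "simple_semigroup ?N"
    by (rule simple_semigroup_epi_image[OF _ semigroup_sandwich[OF C B P'] h])
  then show ?thesis by (rule simple_semigroup_of_sandwich[OF C B P'])
qed

end
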